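(* Let $K$ be an algebraically closed field and let $S=\langle n_1,n_2,n_3,n_4\rangle$ be a $4$-generated pseudo-symmetric numerical semigroup with $n_1<n_2<n_3<n_4$, with associated integer parameters $\alpha_1,\alpha_2,\alpha_3,\alpha_4,\alpha_{21}$ (see context). Assume $\alpha_2>\alpha_{21}+1$ and $\alpha_4=2$, and let $k$ be the smallest positive integer such that $$k(\alpha_2+1)<(k-1)\alpha_1+(k+1)\alpha_{21}+\alpha_3 .$$ Then $$\{f_1,f_2,f_3,f_4,f_5,f_6,\dots,f_{6+k}\}$$ is a standard basis for the toric ideal $I_S\subset K[X_1,X_2,X_3,X_4]$, where $$f_1=X_1^{\alpha_1}-X_3X_4^{\alpha_4-1},\quad f_2=X_2^{\alpha_2}-X_1^{\alpha_{21}}X_4,\quad f_3=X_3^{\alpha_3}-X_1^{\alpha_1-\alpha_{21}-1}X_2,$$ $$f_4=X_4^{\alpha_4}-X_1X_2^{\alpha_2-1}X_3^{\alpha_3-1},\quad f_5=X_1^{\alpha_{21}+1}X_3^{\alpha_3-1}-X_2X_4^{\alpha_4-1},\quad f_6=X_1^{\alpha_1+\alpha_{21}}-X_2^{\alpha_2}X_3,$$ and $$f_{6+j}=X_1^{(j-1)\alpha_1+(j+1)\alpha_{21}+1}X_3^{\alpha_3-j}-X_2^{j\alpha_2+1}\qquad (j=1,2,\dots,k).$$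
   Context: Semigroup. For positive integers $n_1,\dots,n_4$ with $\gcd(n_1,\dots,n_4)=1$, $S=\langle n_1,n_2,n_3,n_4\rangle=\{\sum u_in_i : u_i\in\mathbb{N}\}$. $S$ is pseudo-symmetric if its Frobenius number $F$ (the largest integer not in $S$) is even and $F-x\in S$ for every integer $x\notin S$ with $x\neq F/2$. "4-generated" means $n_1,\dots,n_4$ minimally generate $S$. Parameters. By a theorem of Komeda, which is assumed as the standing description of these semigroups, the $4$-generated pseudo-symmetric semigroup $S$ is given by integers $\alpha_i>1$ ($1\le i\le 4$) and $\alpha_{21}$ with $0<\alpha_{21}<\alpha_1-1$ such that $n_1=\alpha_2\alpha_3(\alpha_4-1)+1$, $n_2=\alpha_{21}\alpha_3\alpha_4+(\alpha_1-\alpha_{21}-1)(\alpha_3-1)+\alpha_3$, $n_3=\alpha_1\alpha_4+(\alpha_1-\alpha_{21}-1)(\alpha_2-1)(\alpha_4-1)-\alpha_4+1$, $n_4=\alpha_1\alpha_2(\alpha_3-1)+\alpha_{21}(\alpha_2-1)+\alpha_2$. Toric ideal. $I_S$ is the kernel of the $K$-algebra map $K[X_1,X_2,X_3,X_4]\to K[t]$, $X_i\mapsto t^{n_i}$. By the same known theorem, $I_S=\langle f_1,f_2,f_3,f_4,f_5\rangle$ with $f_1,\dots,f_5$ as in the claim. Standard basis. Fix a local degree monomial ordering on the monomials in $X_1,\dots,X_4$, i.e. a multiplicative total ordering in which a monomial of smaller total degree is larger than one of larger total degree (ties being broken by some fixed rule, e.g. negative degree reverse lexicographic ordering). ${\rm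 LM}(f)$ is the largest monomial occurring in $f\ne 0$, so it has minimal total degree among the monomials of $f$. A finite set $G\subset I_S$ of nonzero elements is a standard basis of $I_S$ if the ideal generated by $\{{\rm LM}(g): g\in G\}$ equals the ideal generated by $\{{\rm LM}(f): 0\ne f\in I_S\}$. A standard basis is not required to be minimal. *)

theory Defs
  imports
    "HOL-Library.Poly_Mapping"
    "HOL-Library.Numeral_Type"
    "HOL-Computational_Algebra.Polynomial"
begin

section \<open>Numerical semigroups\<close>

text \<open>
  Semigroups are sets of integers, because pseudo-symmetry quantifies over all integers outside
  the semigroup and the Frobenius number of the semigroup of all naturals is \<open>-1\<close>.
\<close>

definition semigroup_gen :: "('v \<Rightarrow> nat) \<Rightarrow> 'v set \<Rightarrow> int set" where
  "semigroup_gen n J = {\<Sum>i\<in>J. int (u i) * int (n i) | u :: 'v \<Rightarrow> nat. True}"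

abbreviation num_semigroup :: "('v \<Rightarrow> nat) \<Rightarrow> int set" where
  "num_semigroup n \<equiv> semigroup_gen n UNIV"

definition minimally_generates :: "('v \<Rightarrow> nat) \<Rightarrow> bool" where
  "minimally_generates n \<longleftrightarrow> (\<forall>J. J \<subset> UNIV \<longrightarrow> semigroup_gen n J \<noteq> num_semigroup n)"

definition frobenius_number :: "int set \<Rightarrow> int" where
  "frobenius_number S = (GREATEST x. x \<notin> S)"

definition pseudo_symmetric :: "int set \<Rightarrow> bool" where
  "pseudo_symmetric S \<longleftrightarrow>
     even (frobenius_number S) \<and>
     (\<forall>x. x \<notin> S \<and> x \<noteq> frobenius_number S div 2 \<longrightarrow> frobenius_number S - x \<in> S)"


section \<open>Polynomial rings\<close>

text \<open>
  Monomials are identified with their exponent vectors; polynomials are finitely supported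
  functions from exponent vectors to coefficients, with the convolution product of
  \<^theory>\<open>HOL-Library.Poly_Mapping\<close>.
\<close>

type_synonym 'v monomial = "'v \<Rightarrow>\<^sub>0 nat"
type_synonym ('v, 'k) mpoly = "'v monomial \<Rightarrow>\<^sub>0 'k"

definition X :: "'v \<Rightarrow> ('v, 'k :: comm_ring_1) mpoly" where
  "X i = Poly_Mapping.single (Poly_Mapping.single i 1) 1"

text \<open>\<open>ideal.span B\<close> is the ideal generated by \<open>B\<close>.\<close>

interpretation ideal: module "(*) :: 'a :: comm_ring_1 \<Rightarrow> 'a \<Rightarrow> 'a"
  by unfold_locales (simp_all add: algebra_simps)

definition toric_map :: "('v :: finite \<Rightarrow> nat) \<Rightarrow> ('v, 'k :: comm_ring_1) mpoly \<Rightarrow> 'k poly" where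
  "toric_map n p =
     (\<Sum>m\<in>Poly_Mapping.keys p. smult (Poly_Mapping.lookup p m) (\<Prod>i\<in>UNIV. monom 1 (n i) ^ Poly_Mapping.lookup m i))"

definition toric_ideal :: "('v :: finite \<Rightarrow> nat) \<Rightarrow> ('v, 'k :: comm_ring_1) mpoly set" where
  "toric_ideal n = {p. toric_map n p = 0}"

text \<open>The following facts identify \<open>toric_map n\<close> as the algebra homomorphism sending
  each \<open>X i\<close> to \<open>t ^ n i\<close>.\<close>

lemma toric_map_X: "toric_map n (X i) = (monom 1 (n i) :: 'k :: comm_ring_1 poly)"
proof -
  have "(\<Prod>j\<in>UNIV. monom 1 (n j) ^ Poly_Mapping.lookup (Poly_Mapping.single i (1::nat)) j)
      = (\<Prod>j\<in>UNIV. if j = i then monom 1 (n j) else (1 :: 'k poly))"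
    by (rule prod.cong) (auto simp: lookup_single when_def)
  thus ?thesis by (simp add: toric_map_def X_def)
qed

lemma toric_map_superset:
  assumes "finite A" "Poly_Mapping.keys p \<subseteq> A"
  shows "toric_map n p = (\<Sum>m\<in>A. smult (Poly_Mapping.lookup p m) (\<Prod>i\<in>UNIV. monom 1 (n i) ^ Poly_Mapping.lookup m i))"
  unfolding toric_map_def
  by (rule sum.mono_neutral_left) (use assms in \<open>auto simp: in_keys_iff\<close>)

lemma toric_map_add: "toric_map n (p + q) = toric_map n p + toric_map n q"
  using Poly_Mapping.keys_add[of p q]
  by (simp add: toric_map_superset[of "Poly_Mapping.keys p \<union> Poly_Mapping.keys q"] lookup_add smult_add_left sum.distrib)

lemma toric_map_single:
  "toric_map n (Poly_Mapping.single m a) = smult a (\<Prod>i\<in>UNIV. monom 1 (n i) ^ Poly_Mapping.lookup m i)"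
  by (cases "a = 0") (simp_all add: toric_map_def)

lemma toric_map_0: "toric_map n 0 = 0"
  by (simp add: toric_map_def)

lemma toric_map_const: "toric_map n (Poly_Mapping.single 0 a) = [:a:]"
  by (simp add: toric_map_single)

lemma toric_map_sum: "toric_map n (\<Sum>x\<in>A. f x) = (\<Sum>x\<in>A. toric_map n (f x))"
  by (induction A rule: infinite_finite_induct) (simp_all add: toric_map_0 toric_map_add)

lemma toric_map_mult:
  fixes p q :: "('v :: finite, 'k :: comm_ring_1) mpoly"
  shows "toric_map n (p * q) = toric_map n p * toric_map n q"
proof -
  let ?s = "\<lambda>(p :: ('v, 'k) mpoly) m. Poly_Mapping.single m (Poly_Mapping.lookup p m)"
  have dec: "r = (\<Sum>m\<in>Poly_Mapping.keys r. ?s r m)" for r :: "('v, 'k) mpoly"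
    by (rule poly_mapping_eqI)
      (auto simp: lookup_sum lookup_single when_def in_keys_iff)
  have "p * q = (\<Sum>m\<in>Poly_Mapping.keys p. \<Sum>m'\<in>Poly_Mapping.keys q. ?s p m * ?s q m')"
    by (subst dec[of p], subst dec[of q]) (simp add: sum_product)
  also have "toric_map n \<dots> = (\<Sum>m\<in>Poly_Mapping.keys p. \<Sum>m'\<in>Poly_Mapping.keys q. toric_map n (?s p m) * toric_map n (?s q m'))"
    by (simp add: toric_map_sum mult_single toric_map_single lookup_add power_add prod.distrib mult_ac)
  also have "\<dots> = toric_map n (\<Sum>m\<in>Poly_Mapping.keys p. ?s p m) * toric_map n (\<Sum>m\<in>Poly_Mapping.keys q. ?s q m)"
    by (simp add: toric_map_sum sum_product)
  finally show ?thesis by (simp flip: dec)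
qed


section \<open>Standard bases\<close>

definition total_degree :: "'v :: finite monomial \<Rightarrow> nat" where
  "total_degree m = (\<Sum>i\<in>UNIV. Poly_Mapping.lookup m i)"

text \<open>\<open>(s, t) \<in> R\<close> is read as \<open>s \<le> t\<close>; monomials of smaller degree are larger.\<close>

definition local_degree_ordering :: "'v :: finite monomial rel \<Rightarrow> bool" where
  "local_degree_ordering R \<longleftrightarrow>
     linear_order R \<and>
     (\<forall>s t u. (s, t) \<in> R \<longrightarrow> (s + u, t + u) \<in> R) \<and>
     (\<forall>s t. total_degree s < total_degree t \<longrightarrow> (t, s) \<in> R)"

definition LM :: "'v monomial rel \<Rightarrow> ('v, 'k :: comm_ring_1) mpoly \<Rightarrow> 'v monomial" where
  "LM R f = (THE m. m \<in> Poly_Mapping.keys f \<and> (\<forall>m'\<in>Poly_Mapping.keys f. (m', m) \<in> R))"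

definition LM_ideal :: "'v monomial rel \<Rightarrow> ('v, 'k :: comm_ring_1) mpoly set \<Rightarrow> ('v, 'k) mpoly set" where
  "LM_ideal R F = ideal.span ((\<lambda>f. Poly_Mapping.single (LM R f) 1) ` {f \<in> F. f \<noteq> 0})"

definition standard_basis ::
  "'v monomial rel \<Rightarrow> ('v, 'k :: comm_ring_1) mpoly set \<Rightarrow> ('v, 'k) mpoly set \<Rightarrow> bool" where
  "standard_basis R G I \<longleftrightarrow>
     finite G \<and> G \<subseteq> I \<and> 0 \<notin> G \<and> LM_ideal R G = LM_ideal R I"

end

theory Submission
  imports Defs
begin

text \<open>
  A toric ideal is spanned by differences of monomials of equal weight, where the weight of a
  monomial is the exponent of its image in \<open>K[t]\<close>. Hence binomials in the ideal form a standard
  basis as soon as distinct monomials that avoid all their leading monomials have distinct weights.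

  Write \<open>n\<^sub>1 = b c + 1\<close> with \<open>b = \<alpha>\<^sub>2\<close> and \<open>c = \<alpha>\<^sub>3\<close>. The binomials show that every weight has the form
  \<open>n\<^sub>1 P + n\<^sub>2 J\<close>, where \<open>P\<close> may be negative. For reduced monomials \<open>J\<close> can be confined to the window
  \<open>[-b (c - K), b K]\<close> of \<open>n\<^sub>1\<close> consecutive integers, \<open>K\<close> being the first index at which the leading
  monomial of \<open>f\<^sub>6\<^sub>+\<^sub>K\<close> is a power of \<open>X\<^sub>2\<close>. As \<open>n\<^sub>1\<close> and \<open>n\<^sub>2\<close> are coprime, the weight determines
  \<open>J\<close> and \<open>P\<close>, and these determine the monomial.
\<close>

text \<open>For multiplication as scalar multiplication this rule reassociates products to the left,
  so it loops together with \<open>algebra_simps\<close>.\<close>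
declare ideal.scale_scale [simp del]

section \<open>Binomial standard bases of toric ideals\<close>

definition weight :: "('v :: finite \<Rightarrow> nat) \<Rightarrow> 'v monomial \<Rightarrow> nat" where
  "weight n m = (\<Sum>i\<in>UNIV. Poly_Mapping.lookup m i * n i)"

lemma weight_add: "weight n (s + t) = weight n s + weight n t"
  by (simp add: weight_def lookup_add sum.distrib algebra_simps)

lemma toric_map_eq_sum_monom:
  fixes p :: "('v :: finite, 'k :: comm_ring_1) mpoly"
  shows "toric_map n p = (\<Sum>m\<in>Poly_Mapping.keys p. monom (Poly_Mapping.lookup p m) (weight n m))"
proof -
  have "(\<Prod>i\<in>A. monom 1 (n i) ^ Poly_Mapping.lookup m i)
      = (monom 1 (\<Sum>i\<in>A. Poly_Mapping.lookup m i * n i) :: 'k poly)" if "finite A" for m A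
    using that by (induction A) (simp_all add: monom_power mult_monom mult.commute)
  then show ?thesis
    by (simp add: toric_map_def weight_def smult_monom)
qed

lemma toric_map_diff:
  fixes p q :: "('v :: finite, 'k :: comm_ring_1) mpoly"
  shows "toric_map n (p - q) = toric_map n p - toric_map n q"
  using toric_map_add[of n "p - q" q] by simp

lemma binomial_in_toric_ideal:
  assumes "weight n s = weight n t"
  shows "Poly_Mapping.single s 1 - Poly_Mapping.single t 1
           \<in> (toric_ideal n :: ('v :: finite, 'k :: comm_ring_1) mpoly set)"
  using assms by (simp add: toric_ideal_def toric_map_diff) (simp add: toric_map_eq_sum_monom)

text \<open>The coefficient of the image at this weight sums the coefficients over the whole fibre.
  It vanishes, while a key alone in its fibre would leave its own nonzero coefficient.\<close>

lemma toric_ideal_other_key: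
  fixes p :: "('v :: finite, 'k :: comm_ring_1) mpoly"
  assumes "p \<in> toric_ideal n" and m: "m \<in> Poly_Mapping.keys p"
  obtains m' where "m' \<in> Poly_Mapping.keys p" "m' \<noteq> m" "weight n m' = weight n m"
proof (rule ccontr)
  assume "\<not> thesis"
  with that have *: "weight n m' \<noteq> weight n m" if "m' \<in> Poly_Mapping.keys p - {m}" for m'
    using that by blast
  have "0 = coeff (toric_map n p) (weight n m)"
    using assms by (simp add: toric_ideal_def)
  also have "\<dots> = (\<Sum>m'\<in>Poly_Mapping.keys p.
      if weight n m' = weight n m then Poly_Mapping.lookup p m' else 0)"
    by (simp add: toric_map_eq_sum_monom coeff_sum)
  also have "\<dots> = Poly_Mapping.lookup p m"
    using * by (simp add: sum.remove[OF _ m])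
  finally show False
    using m by (simp add: in_keys_iff)
qed

text \<open>Positivity bounds every exponent by the weight, so a fibre embeds into a finite set of
  bounded functions.\<close>

lemma finite_weight_fibre:
  fixes n :: "'v :: finite \<Rightarrow> nat"
  assumes "\<And>i. n i > 0"
  shows "finite {m. weight n m = d}"
proof (rule finite_imageD)
  have "Poly_Mapping.lookup m i \<le> weight n m" for m i
  proof -
    have "Poly_Mapping.lookup m i \<le> Poly_Mapping.lookup m i * n i"
      using assms[of i] by simp
    also have "\<dots> \<le> weight n m"
      unfolding weight_def by (rule member_le_sum) auto
    finally show ?thesis .
  qed
  then have "Poly_Mapping.lookup ` {m. weight n m = d} \<subseteq> {h. \<forall>i. (i \<in> UNIV \<longrightarrow> h i \<in> {..d}) \<and> (i \<notin> UNIV \<longrightarrow> h i = 0)}"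
    by auto
  then show "finite (Poly_Mapping.lookup ` {m. weight n m = d})"
    by (rule finite_subset) (intro finite_set_of_finite_funs; simp)
  show "inj_on Poly_Mapping.lookup {m. weight n m = d}"
    by (rule inj_onI) (simp add: lookup_inject)
qed

text \<open>Applied to the ordering this gives the least monomial of a fibre; applied to its
  converse, the leading monomial.\<close>

lemma linear_order_finite_min:
  assumes R: "linear_order R" and "finite A" "A \<noteq> {}"
  shows "\<exists>x\<in>A. \<forall>y\<in>A. (x, y) \<in> R"
  using assms(2,3)
proof (induction rule: finite_ne_induct)
  case (singleton x)
  show ?case using R
    by (auto simp: order_on_defs refl_on_def)
next
  case (insert z A)
  then obtain x where x: "x \<in> A" "\<forall>y\<in>A. (x, y) \<in> R" by blast
  have refl: "(z, z) \<in> R" and trans: "trans R" and "total R"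
    using R by (auto simp: order_on_defs refl_on_def)
  then have "(x, z) \<in> R \<or> (z, x) \<in> R"
    by (cases "x = z") (auto simp: total_on_def)
  with x refl trans show ?case by (metis insert_iff transD)
qed

lemma LM_eqI:
  assumes R: "linear_order R" and "m \<in> Poly_Mapping.keys f"
    and "\<And>m'. m' \<in> Poly_Mapping.keys f \<Longrightarrow> (m', m) \<in> R"
  shows "LM R f = m"
  unfolding LM_def
proof (rule the_equality)
  fix m' assume "m' \<in> Poly_Mapping.keys f \<and> (\<forall>x\<in>Poly_Mapping.keys f. (x, m') \<in> R)"
  moreover have "antisym R"
    using R by (simp add: order_on_defs)
  ultimately show "m' = m"
    using assms(2,3) by (metis antisymD)
qed (use assms in auto)

lemma LM_greatest:
  assumes R: "linear_order R" and "f \<noteq> 0"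
  shows "LM R f \<in> Poly_Mapping.keys f" and "\<And>m. m \<in> Poly_Mapping.keys f \<Longrightarrow> (m, LM R f) \<in> R"
proof -
  have "\<exists>m\<in>Poly_Mapping.keys f. \<forall>m'\<in>Poly_Mapping.keys f. (m, m') \<in> R\<inverse>"
    using assms by (intro linear_order_finite_min) auto
  then obtain m where "m \<in> Poly_Mapping.keys f" "\<forall>m'\<in>Poly_Mapping.keys f. (m', m) \<in> R"
    by auto
  then show "LM R f \<in> Poly_Mapping.keys f" "\<And>m. m \<in> Poly_Mapping.keys f \<Longrightarrow> (m, LM R f) \<in> R"
    using LM_eqI[OF R, of m f] by auto
qed

lemma keys_binomial:
  assumes "s \<noteq> t"
  shows "Poly_Mapping.keys (Poly_Mapping.single s 1 - Poly_Mapping.single t (1 :: 'k :: comm_ring_1)) = {s, t}"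
  using assms by (auto simp: in_keys_iff lookup_minus lookup_single when_def split: if_splits)

lemma LM_binomial:
  assumes "linear_order R" "s \<noteq> t" "(t, s) \<in> R"
  shows "LM R (Poly_Mapping.single s 1 - Poly_Mapping.single t (1 :: 'k :: comm_ring_1)) = s"
    and "LM R (Poly_Mapping.single t 1 - Poly_Mapping.single s (1 :: 'k :: comm_ring_1)) = s"
  using assms by (auto intro!: LM_eqI simp: keys_binomial order_on_defs refl_on_def)

text \<open>The standard monomials of \<open>G\<close>: divisibility is the componentwise order on
  exponent vectors, so indivisibility means that some exponent falls short.\<close>

definition reduced :: "'v monomial rel \<Rightarrow> ('v, 'k :: comm_ring_1) mpoly set \<Rightarrow> 'v monomial \<Rightarrow> bool" where
  "reduced R G m \<longleftrightarrow> (\<forall>g\<in>G. \<exists>i. Poly_Mapping.lookup m i < Poly_Mapping.lookup (LM R g) i)"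

lemma monomial_eq_LM_add:
  assumes "\<not> reduced R G m"
  obtains g u where "g \<in> G" "m = LM R g + u"
proof -
  obtain g where g: "g \<in> G" "\<And>i. Poly_Mapping.lookup (LM R g) i \<le> Poly_Mapping.lookup m i"
    using assms by (auto simp: reduced_def not_less)
  then have "m = LM R g + (m - LM R g)"
    by (intro poly_mapping_eqI) (simp add: lookup_add lookup_minus)
  with g(1) show thesis by (rule that)
qed

text \<open>For a local ordering, reduction modulo a binomial decreases a monomial inside its finite
  fibre, so it ends in a reduced monomial. If every fibre contains only one of these, then it is
  the least monomial of the fibre, hence it does not lead an element of the ideal.\<close>

lemma standard_basis_toric_idealI:
  fixes n :: "'v :: finite \<Rightarrow> nat" and G :: "('v, 'k :: comm_ring_1) mpoly set"
  assumes R: "local_degree_ordering R" and n: "\<And>i. n i > 0" and G: "finite G"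
    and binomial: "\<And>g. g \<in> G \<Longrightarrow> \<exists>s t. s \<noteq> t \<and> weight n s = weight n t \<and>
                     g = Poly_Mapping.single s 1 - Poly_Mapping.single t 1"
    and inj: "inj_on (weight n) {m. reduced R G m}"
  shows "standard_basis R G (toric_ideal n)"
proof -
  have lin: "linear_order R" and compat: "\<And>s t u. (s, t) \<in> R \<Longrightarrow> (s + u, t + u) \<in> R"
    using R unfolding local_degree_ordering_def by blast+
  have anti: "antisym R" and trans: "trans R"
    using lin by (auto simp: order_on_defs)
  have GI: "G \<subseteq> toric_ideal n"
    using binomial binomial_in_toric_ideal by blast
  have G0: "0 \<notin> G"
  proof
    assume "0 \<in> G"
    then obtain s t :: "'v monomial" where "s \<noteq> t"
      "(0 :: ('v, 'k) mpoly) = Poly_Mapping.single s 1 - Poly_Mapping.single t 1"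
      using binomial by blast
    then show False using keys_binomial[of s t, where 'k = 'k] by auto
  qed

  have reduce: "\<exists>m'. reduced R G m' \<and> weight n m' = weight n m \<and> (m', m) \<in> R" for m
  proof -
    let ?A = "{m'. weight n m' = weight n m \<and> (m', m) \<in> R}"
    have "finite ?A"
      by (rule finite_subset[OF _ finite_weight_fibre[OF n]]) auto
    moreover have "m \<in> ?A"
      using lin by (simp add: order_on_defs refl_on_def)
    \<comment> \<open>Minimality replaces iteration: a least element of \<open>?A\<close> admits no
      further reduction.\<close>
    ultimately obtain m' where m': "m' \<in> ?A" "\<And>x. x \<in> ?A \<Longrightarrow> (m', x) \<in> R"
      using linear_order_finite_min[OF lin, of ?A] by blast
    have "reduced R G m'"
    proof (rule ccontr)
      assume "\<not> reduced R G m'"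
      then obtain g u where g: "g \<in> G" "m' = LM R g + u" by (rule monomial_eq_LM_add)
      obtain s t where st: "s \<noteq> t" "weight n s = weight n t"
        and gst: "g = Poly_Mapping.single s 1 - Poly_Mapping.single t 1"
        using binomial[OF g(1)] by blast
      have "g \<noteq> 0" using g(1) G0 by blast
      have keys: "Poly_Mapping.keys g = {s, t}"
        using st(1) by (simp add: gst keys_binomial)
      \<comment> \<open>Trading \<open>LM R g\<close> for the other monomial \<open>t'\<close> stays
        in \<open>?A\<close>: the weight is kept, and compatibility of \<open>R\<close> excludes an
        increase. Minimality of \<open>m'\<close> then forces \<open>t' = LM R g\<close>.\<close>
      obtain t' where t': "t' \<in> Poly_Mapping.keys g" "t' \<noteq> LM R g"
        using keys st(1) by auto
      have LMst: "LM R g \<in> {s, t}"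
        using LM_greatest(1)[OF lin \<open>g \<noteq> 0\<close>] by (simp add: keys)
      have "weight n t' = weight n (LM R g)"
        using t' LMst st(2) by (auto simp: keys)
      moreover have less: "(t' + u, m') \<in> R"
        unfolding g(2) by (rule compat[OF LM_greatest(2)[OF lin \<open>g \<noteq> 0\<close> t'(1)]])
      ultimately have "t' + u \<in> ?A"
        using m'(1) g(2) transD[OF trans less, of m] by (simp add: weight_add)
      then have "t' + u = m'"
        using antisymD[OF anti less m'(2)] by simp
      then show False using g(2) t'(2) by simp
    qed
    with m'(1) show ?thesis by blast
  qed

  have "Poly_Mapping.single (LM R f) 1 \<in> LM_ideal R G" if f: "f \<in> toric_ideal n" "f \<noteq> 0" for f
  proof -
    have "\<not> reduced R G (LM R f)"
    proof
      assume red: "reduced R G (LM R f)"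
      \<comment> \<open>A companion \<open>m\<close> of equal weight reduces, by injectivity, to
        \<open>LM R f\<close> itself. So \<open>LM R f\<close> lies below \<open>m\<close>, yet as
        leading monomial it also lies above \<open>m\<close>.\<close>
      obtain m where m: "m \<in> Poly_Mapping.keys f" "m \<noteq> LM R f" "weight n m = weight n (LM R f)"
        using toric_ideal_other_key[OF f(1) LM_greatest(1)[OF lin f(2)]] .
      obtain m' where m': "reduced R G m'" "weight n m' = weight n m" "(m', m) \<in> R"
        using reduce by blast
      have "m' = LM R f"
        using inj red m'(1,2) m(3) by (auto dest: inj_onD)
      then show False
        using m'(3) m(2) antisymD[OF anti _ LM_greatest(2)[OF lin f(2) m(1)]] by blast
    qed
    then obtain g u where g: "g \<in> G" "LM R f = LM R g + u" by (rule monomial_eq_LM_add)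
    have "Poly_Mapping.single (LM R g) (1 :: 'k) \<in> LM_ideal R G"
      unfolding LM_ideal_def using g(1) G0 by (intro ideal.span_base) auto
    then have "Poly_Mapping.single u 1 * Poly_Mapping.single (LM R g) (1 :: 'k) \<in> LM_ideal R G"
      unfolding LM_ideal_def by (rule ideal.span_scale)
    then show ?thesis
      by (simp add: mult_single g(2) add.commute)
  qed
  then have "LM_ideal R (toric_ideal n :: ('v, 'k) mpoly set) \<subseteq> LM_ideal R G"
    unfolding LM_ideal_def[of R "toric_ideal n"]
    by (intro ideal.span_minimal) (auto simp: LM_ideal_def)
  moreover have "LM_ideal R G \<subseteq> LM_ideal R (toric_ideal n)"
    unfolding LM_ideal_def using GI by (intro ideal.span_mono) auto
  ultimately show ?thesis
    using G GI G0 by (auto simp: standard_basis_def)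
qed

section \<open>Monomials in four variables\<close>

definition mon :: "nat \<Rightarrow> nat \<Rightarrow> nat \<Rightarrow> nat \<Rightarrow> 4 monomial" where
  "mon p q r s = Poly_Mapping.single 1 p + Poly_Mapping.single 2 q
     + Poly_Mapping.single 3 r + Poly_Mapping.single 4 s"

text \<open>Arithmetic in the type \<open>4\<close> is modulo 4, so the index \<open>4\<close> is
  its zero element. The four numerals are distinct and exhaust the type by cardinality.\<close>

lemma UNIV_4: "(UNIV :: 4 set) = {1, 2, 3, 4}"
  by (rule card_subset_eq[symmetric]) auto

lemma sum_4: "(\<Sum>i\<in>UNIV. g i) = g 1 + g 2 + g 3 + g (4 :: 4)"
  unfolding UNIV_4 by (simp add: add.assoc)

lemma all_4: "(\<forall>i :: 4. P i) \<longleftrightarrow> P 1 \<and> P 2 \<and> P 3 \<and> P 4"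
  using UNIV_4 by (metis UNIV_I emptyE insertE)

lemma lookup_mon:
  "Poly_Mapping.lookup (mon p q r s) 1 = p" "Poly_Mapping.lookup (mon p q r s) 2 = q"
  "Poly_Mapping.lookup (mon p q r s) 3 = r" "Poly_Mapping.lookup (mon p q r s) 4 = s"
  by (simp_all add: mon_def lookup_add lookup_single when_def)

lemma mon_eq_iff: "mon p q r s = mon p' q' r' s' \<longleftrightarrow> p = p' \<and> q = q' \<and> r = r' \<and> s = s'"
  by (metis lookup_mon)

lemma mon_surj: obtains p q r s where "m = mon p q r s"
proof
  show "m = mon (Poly_Mapping.lookup m 1) (Poly_Mapping.lookup m 2)
      (Poly_Mapping.lookup m 3) (Poly_Mapping.lookup m 4)"
    by (rule poly_mapping_eqI, rule spec[OF all_4[THEN iffD2]]) (simp add: lookup_mon)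
qed

lemma weight_mon: "weight n (mon p q r s) = p * n 1 + q * n 2 + r * n 3 + s * n 4"
  by (simp only: weight_def sum_4 lookup_mon)

lemma total_degree_mon: "total_degree (mon p q r s) = p + q + r + s"
  by (simp only: total_degree_def sum_4 lookup_mon)

lemma X_power: "X i ^ k = Poly_Mapping.single (Poly_Mapping.single i k) 1"
proof (induction k)
  case (Suc k)
  have "Poly_Mapping.single i 1 + Poly_Mapping.single i k = Poly_Mapping.single i (1 + k)"
    by (rule single_add[symmetric])
  with Suc show ?case by (simp add: X_def mult_single)
qed simp

lemma X_mon:
  "X 1 ^ p * X 2 ^ q * X 3 ^ r * X 4 ^ s = Poly_Mapping.single (mon p q r s) 1"
  by (simp add: X_power mult_single mon_def)

section \<open>Weights of reduced monomials\<close>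

text \<open>Here \<open>a, b, c, e\<close> stand for
  \<open>\<alpha> 1, \<alpha> 2, \<alpha> 3, \<alpha>21\<close>, and \<open>\<alpha> 4 = 2\<close>.
  Each relation equates the weights of the two monomials of one of \<open>f 1\<close> to
  \<open>f 5\<close>. The unsimplified \<open>2 - 1\<close> keeps the shape of Komeda's formula
  after inserting \<open>\<alpha> 4 = 2\<close>.\<close>

lemma komeda_relations:
  fixes a b c e n1 n2 n3 n4 :: nat
  assumes "e + 1 < a" "b > 0" "c > 0"
    and n1: "n1 = b * c + 1"
    and n2: "n2 = e * c * 2 + (a - e - 1) * (c - 1) + c"
    and n3: "n3 = a * 2 + (a - e - 1) * (b - 1) * (2 - 1) - 2 + 1"
    and n4: "n4 = a * b * (c - 1) + e * (b - 1) + b"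
  shows "a * n1 = n3 + n4" and "b * n2 = e * n1 + n4" and "c * n3 = (a - e - 1) * n1 + n2"
    and "2 * n4 = n1 + (b - 1) * n2 + (c - 1) * n3" and "(e + 1) * n1 + (c - 1) * n3 = n2 + n4"
proof -
  \<comment> \<open>Successor forms remove the truncated subtractions; polynomial identities
    remain.\<close>
  obtain a' where a: "a = a' + e + 2"
    using assms(1) by (metis add.commute add_2_eq_Suc' less_imp_Suc_add add.assoc Suc_eq_plus1 add_Suc_right)
  obtain b' c' where bc: "b = Suc b'" "c = Suc c'"
    using assms(2,3) gr0_implies_Suc by blast
  have "n1 = (b' + 1) * (c' + 1) + 1" "n2 = 2 * e * (c' + 1) + (a' + 1) * c' + c' + 1"
    "n3 = 2 * (a' + e + 1) + (a' + 1) * b' + 1"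
    "n4 = (a' + e + 2) * (b' + 1) * c' + e * b' + b' + 1"
    by (simp_all add: n1 n2 n3 n4 a bc)
  note * = this
  show "a * n1 = n3 + n4" "b * n2 = e * n1 + n4" "c * n3 = (a - e - 1) * n1 + n2"
    "2 * n4 = n1 + (b - 1) * n2 + (c - 1) * n3" "(e + 1) * n1 + (c - 1) * n3 = n2 + n4"
    by (simp_all add: * a bc algebra_simps)
qed

text \<open>The first two relations give \<open>(a + e) * n1 = b * n2 + n3\<close>. Each induction
  step trades one \<open>n3\<close> for \<open>(a + e) * n1\<close>, which adds
  \<open>b * n2\<close>. The case \<open>j = 1\<close> is the third relation plus
  \<open>e * n1\<close>. The bound \<open>j \<le> c\<close> keeps \<open>c - j\<close>
  exact.\<close>

lemma weight_chain:
  fixes a b c e n1 n2 n3 n4 :: nat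
  assumes "a * n1 = n3 + n4" "b * n2 = e * n1 + n4" "(e + 1) * n1 + (c - 1) * n3 = n2 + n4"
    and "1 \<le> j" "j \<le> c"
  shows "((j - 1) * a + (j + 1) * e + 1) * n1 + (c - j) * n3 = (j * b + 1) * n2"
  using assms(4,5)
proof (induction j rule: dec_induct)
  case base
  then show ?case using assms(2,3) by (simp add: algebra_simps)
next
  case (step j)
  have "c - j = Suc (c - Suc j)" using step by simp
  moreover obtain i where "j = Suc i" using step(1) by (cases j) auto
  ultimately show ?case using step assms(1,2) by (simp add: algebra_simps)
qed

text \<open>Exponents left by the leading monomials: the clause on \<open>s\<close> comes from
  \<open>f 1\<close>, \<open>f 2\<close>, \<open>f 4\<close> and \<open>f 5\<close>, then
  \<open>r < c\<close> from \<open>f 3\<close>, the next one from \<open>f 6\<close>, the bound on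
  \<open>q\<close> from \<open>f (6 + K)\<close>, and the last clause from \<open>f (6 + j)\<close>
  with \<open>j < K\<close>.\<close>

definition reduced_exponents :: "nat \<Rightarrow> nat \<Rightarrow> nat \<Rightarrow> nat \<Rightarrow> nat \<Rightarrow> nat \<times> nat \<times> nat \<times> nat \<Rightarrow> bool" where
  "reduced_exponents a b c e K = (\<lambda>(p, q, r, s).
     (s = 0 \<or> s = 1 \<and> q = 0 \<and> r = 0 \<and> p < e) \<and> r < c \<and> (r = 0 \<or> q < b) \<and> q \<le> K * b \<and>
     (\<forall>j. 1 \<le> j \<longrightarrow> j < K \<longrightarrow> c - j \<le> r \<longrightarrow> p < (j - 1) * a + (j + 1) * e + 1))"

text \<open>Modulo \<open>n1\<close> every weight is a multiple of \<open>n2\<close>, and \<open>J\<close> is the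
  representative of this multiple in a window of length \<open>n1 = b c + 1\<close>.\<close>

definition exponent_coords :: "nat \<Rightarrow> nat \<Rightarrow> nat \<Rightarrow> nat \<Rightarrow> nat \<Rightarrow> nat \<times> nat \<times> nat \<times> nat \<Rightarrow> int \<times> int" where
  "exponent_coords a b c e K = (\<lambda>(p, q, r, s).
     if s = 1 then (int p - int e, int b)
     else if r \<le> c - K then (int p + (int a + int e) * int r, int q - int b * int r)
     else (int p - int ((c - r - 1) * a + (c - r + 1) * e + 1), int q + int b * int (c - r) + 1))"

text \<open>Over the integers \<open>n3\<close> and \<open>n4\<close> are combinations of
  \<open>n1\<close> and \<open>n2\<close>, which settles all but large \<open>r\<close>. There
  \<open>weight_chain\<close> at \<open>j = c - r\<close> replaces \<open>r * n3\<close>; compared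
  with the branch for small \<open>r\<close>, it raises \<open>J\<close> by
  \<open>b * c + 1\<close>.\<close>

lemma weight_exponent_coords:
  fixes a b c e n1 n2 n3 n4 :: nat
  assumes rel: "a * n1 = n3 + n4" "b * n2 = e * n1 + n4" "(e + 1) * n1 + (c - 1) * n3 = n2 + n4"
    and red: "reduced_exponents a b c e K (p, q, r, s)"
    and coords: "exponent_coords a b c e K (p, q, r, s) = (P, J)"
  shows "int (p * n1 + q * n2 + r * n3 + s * n4) = P * int n1 + J * int n2"
proof -
  have n4: "int n4 = int b * int n2 - int e * int n1"
    using arg_cong[OF rel(2), of int] by simp
  have n3: "int n3 = (int a + int e) * int n1 - int b * int n2"
    using arg_cong[OF rel(1), of int] n4 by (simp add: algebra_simps)
  consider "s = 1" | "s \<noteq> 1" "r \<le> c - K" | "s \<noteq> 1" "\<not> r \<le> c - K" by blast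
  then show ?thesis
  proof cases
    case 1
    then show ?thesis using red coords
      by (auto simp: reduced_exponents_def exponent_coords_def n4 algebra_simps)
  next
    case 2
    then have "s = 0" using red by (auto simp: reduced_exponents_def)
    moreover have "P = int p + (int a + int e) * int r" "int q = J + int b * int r"
      using 2 coords by (simp_all add: exponent_coords_def)
    ultimately show ?thesis
      by (simp add: n3 algebra_simps)
  next
    case 3
    then have s: "s = 0" and r: "r < c" using red by (auto simp: reduced_exponents_def)
    define B where "B = (c - r - 1) * a + (c - r + 1) * e + 1"
    have "B * n1 + r * n3 = ((c - r) * b + 1) * n2"
      using weight_chain[OF rel, of "c - r"] r by (simp add: B_def)
    then have "int B * int n1 + int r * int n3 = (int (c - r) * int b + 1) * int n2"
      using of_nat_eq_iff[where 'a = int] by (metis of_nat_add of_nat_mult of_nat_1)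
    moreover have "int p = P + int B" "J = int q + int b * int (c - r) + 1"
      using 3 coords by (auto simp: exponent_coords_def B_def)
    ultimately show ?thesis using s by (simp add: algebra_simps)
  qed
qed

text \<open>The cut at \<open>r = c - K\<close> keeps \<open>q - b * r\<close> from falling below
  the window; beyond it the shifted value has to stay under the upper end.\<close>

lemma exponent_coords_range:
  assumes "1 \<le> K" "K \<le> c"
    and red: "reduced_exponents a b c e K (p, q, r, s)"
    and coords: "exponent_coords a b c e K (p, q, r, s) = (P, J)"
  shows "- (int b * int (c - K)) \<le> J" and "J \<le> int b * int K"
proof -
  have "- (int b * int (c - K)) \<le> J \<and> J \<le> int b * int K"
  proof (cases "s = 1")
    case True
    have "int b * 1 \<le> int b * int K" using assms(1) by (intro mult_left_mono) auto
    moreover have "0 \<le> int b * int (c - K)" by simp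
    moreover have "J = int b" using coords True by (simp add: exponent_coords_def)
    ultimately show ?thesis by linarith
  next
    case s: False
    show ?thesis
    proof (cases "r \<le> c - K")
      case True
      then have J: "J = int q - int b * int r"
        using coords s by (simp add: exponent_coords_def)
      have "int b * int r \<le> int b * int (c - K)"
        using True by (intro mult_left_mono) auto
      moreover have "int q \<le> int b * int K"
        using red by (auto simp: reduced_exponents_def mult.commute simp flip: of_nat_mult)
      moreover have "0 \<le> int b * int r" by simp
      ultimately show ?thesis using J by linarith
    next
      case False
      then have J: "J = int q + int b * int (c - r) + 1" and "q < b"
        using coords s red by (auto simp: exponent_coords_def reduced_exponents_def)
      \<comment> \<open>Since \<open>q < b\<close>, the part \<open>q + 1\<close> is at most
        \<open>b\<close>, and \<open>r > c - K\<close> gives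
        \<open>c - r + 1 \<le> K\<close>.\<close>
      moreover have "int b * (int (c - r) + 1) \<le> int b * int K"
        using False assms by (intro mult_left_mono) auto
      moreover have "0 \<le> int b * int (c - r)" "0 \<le> int b * int (c - K)" by auto
      ultimately show ?thesis unfolding distrib_left by linarith
    qed
  qed
  then show "- (int b * int (c - K)) \<le> J" "J \<le> int b * int K" by auto
qed

lemma mult_add_unique:
  fixes q q' r r' b :: nat
  assumes "q < b" "q' < b" "int q - int b * int r = int q' - int b * int r'"
  shows "q = q'" "r = r'"
proof -
  have "int (q + b * r') = int (q' + b * r)" using assms(3) by simp
  then have *: "q + b * r' = q' + b * r" by linarith
  have "(q + b * r') mod b = q" "(q' + b * r) mod b = q'" using assms by simp_all
  then show "q = q'" using * by simp
  then show "r = r'" using * assms(1) by simp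
qed

text \<open>Four regions are told apart by position: \<open>s = 1\<close> gives \<open>P < 0\<close>
  and \<open>J = b\<close>; \<open>s = r = 0\<close> gives \<open>P \<ge> 0\<close> and
  \<open>J \<ge> 0\<close>; small positive \<open>r\<close> gives \<open>J < 0\<close>; large
  \<open>r\<close> gives \<open>P < 0\<close> and \<open>J > b\<close>. In the last two, division
  with remainder by \<open>b\<close> recovers \<open>q\<close> and \<open>r\<close> from
  \<open>J\<close>, and then \<open>P\<close> yields \<open>p\<close>.\<close>

lemma inj_on_exponent_coords:
  assumes "1 \<le> K" "K \<le> c" "b > 0"
  shows "inj_on (exponent_coords a b c e K) {x. reduced_exponents a b c e K x}"
proof (rule inj_onI, simp only: split_paired_all mem_Collect_eq prod.case prod.inject)
  let ?red = "\<lambda>p q r s. reduced_exponents a b c e K (p, q, r, s)"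
  let ?ec = "\<lambda>p q r s. exponent_coords a b c e K (p, q, r, s)"
  have cases: "s = 1 \<and> q = 0 \<and> r = 0 \<and> P = int p - int e \<and> J = int b \<and> P < 0
     \<or> s = 0 \<and> r = 0 \<and> P = int p \<and> J = int q
     \<or> s = 0 \<and> r > 0 \<and> q < b \<and> P = int p + (int a + int e) * int r \<and> J = int q - int b * int r \<and> P \<ge> 0 \<and> J < 0
     \<or> s = 0 \<and> q < b \<and> r < c \<and> P = int p - int ((c - r - 1) * a + (c - r + 1) * e + 1)
        \<and> J = int q + int b * int (c - r) + 1 \<and> P < 0 \<and> J > int b"
    if "?red p q r s" "?ec p q r s = (P, J)" for p q r s P J
  proof -
    have "s = 0 \<or> s = 1" using that(1) by (auto simp: reduced_exponents_def)
    then consider "s = 1" | "s = 0" "r = 0" | "s = 0" "0 < r" "r \<le> c - K" | "s = 0" "\<not> r \<le> c - K"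
      by (metis not_gr_zero)
    then show ?thesis
    proof cases
      case 3
      then have "q < b" "J = int q - int b * int r" using that
        by (auto simp: reduced_exponents_def exponent_coords_def)
      moreover have "int b * 1 \<le> int b * int r" using 3 by (intro mult_left_mono) auto
      ultimately have "q < b" "J = int q - int b * int r" "J < 0" by linarith+
      moreover have P: "P = int p + (int a + int e) * int r"
        using 3 that by (auto simp: exponent_coords_def)
      moreover have "P \<ge> 0" unfolding P by simp
      ultimately show ?thesis using 3 by blast
    next
      case 4
      then have r: "r > 0" "r < c" "q < b" using that(1) by (auto simp: reduced_exponents_def)
      \<comment> \<open>The index \<open>j = c - r\<close> of the last clause of
        \<open>reduced_exponents\<close> bounds \<open>p\<close>, and this makes \<open>P\<close>
        negative.\<close>
      have "1 \<le> c - r \<and> c - r < K \<and> c - (c - r) \<le> r" using 4 r assms by auto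
      then have "p < (c - r - 1) * a + (c - r + 1) * e + 1"
        using that(1) unfolding reduced_exponents_def prod.case by blast
      moreover have PJ: "P = int p - int ((c - r - 1) * a + (c - r + 1) * e + 1)"
        "J = int q + int b * int (c - r) + 1"
        using 4 that(2) by (auto simp: exponent_coords_def)
      ultimately have "P < 0" unfolding PJ by (simp only: diff_less_0_iff_less of_nat_less_iff)
      have "int b * 1 \<le> int b * int (c - r)" using r by (intro mult_left_mono) auto
      then have "J > int b" unfolding PJ by linarith
      then show ?thesis using 4 r PJ \<open>P < 0\<close> by blast
    qed (use that in \<open>auto simp: reduced_exponents_def exponent_coords_def\<close>)
  qed
  fix p q r s p' q' r' s'
  assume red: "?red p q r s" "?red p' q' r' s'" and eq: "?ec p q r s = ?ec p' q' r' s'"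
  obtain P J where PJ: "?ec p q r s = (P, J)" by fastforce
  note c1 = cases[OF red(1) PJ] and c2 = cases[OF red(2) PJ[unfolded eq]]
  have B: "q = q' \<and> r = r'"
    if "int q + int b * int (c - r) + 1 = int q' + int b * int (c - r') + 1" "q < b" "q' < b" "r < c" "r' < c"
  proof -
    have "q = q'" "c - r = c - r'"
      using mult_add_unique[of q b q' "c - r'" "c - r"] that by simp_all
    then show ?thesis using that by simp
  qed
  from c1 c2 show "p = p' \<and> q = q' \<and> r = r' \<and> s = s'"
    by (elim disjE; simp; use mult_add_unique[of q b q' r r'] B in auto)
qed

lemma inj_on_weight_reduced_exponents:
  fixes a b c e n1 n2 n3 n4 :: nat
  assumes rel: "a * n1 = n3 + n4" "b * n2 = e * n1 + n4" "(e + 1) * n1 + (c - 1) * n3 = n2 + n4"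
    and n1: "n1 = b * c + 1" and cop: "coprime n1 n2"
    and K: "1 \<le> K" "K \<le> c" and "b > 0"
  shows "inj_on (\<lambda>(p, q, r, s). p * n1 + q * n2 + r * n3 + s * n4) {x. reduced_exponents a b c e K x}"
proof (rule inj_onI, simp only: split_paired_all mem_Collect_eq prod.case prod.inject)
  fix p q r s p' q' r' s'
  assume red: "reduced_exponents a b c e K (p, q, r, s)" "reduced_exponents a b c e K (p', q', r', s')"
    and eq: "p * n1 + q * n2 + r * n3 + s * n4 = p' * n1 + q' * n2 + r' * n3 + s' * n4"
  obtain P J where PJ: "exponent_coords a b c e K (p, q, r, s) = (P, J)" by fastforce
  obtain P' J' where PJ': "exponent_coords a b c e K (p', q', r', s') = (P', J')" by fastforce
  have w: "P * int n1 + J * int n2 = P' * int n1 + J' * int n2"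
    using weight_exponent_coords[OF rel red(1) PJ] weight_exponent_coords[OF rel red(2) PJ'] eq by simp
  then have "(J - J') * int n2 = int n1 * (P' - P)" by (simp add: algebra_simps)
  then have "int n1 dvd (J - J') * int n2" by simp
  then have dvd: "int n1 dvd J - J'"
    using cop by (simp add: coprime_dvd_mult_left_iff)
  \<comment> \<open>The window has \<open>b * c + 1 = n1\<close> elements, so members congruent
    modulo \<open>n1\<close> coincide.\<close>
  have "int b * int (c - K) + int b * int K = int b * int c"
    using K by (simp add: algebra_simps of_nat_diff)
  then have "\<bar>J - J'\<bar> < int n1"
    using exponent_coords_range[OF K red(1) PJ] exponent_coords_range[OF K red(2) PJ'] n1 by auto
  with dvd have J: "J = J'"
    using dvd_imp_le_int[of "J - J'" "int n1"] by fastforce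
  from w J have "P * int n1 = P' * int n1" by simp
  moreover have "int n1 \<noteq> 0" unfolding n1 by linarith
  ultimately have "P = P'" by simp
  with J PJ PJ' have "exponent_coords a b c e K (p, q, r, s) = exponent_coords a b c e K (p', q', r', s')"
    by simp
  then show "p = p' \<and> q = q' \<and> r = r' \<and> s = s'"
    using inj_on_exponent_coords[OF K \<open>b > 0\<close>] red by (auto dest: inj_onD)
qed

theorem theorem2p1:
  fixes n \<alpha> :: "4 \<Rightarrow> nat" and \<alpha>21 k :: nat
    and R :: "4 monomial rel"
    and f :: "nat \<Rightarrow> (4, 'k :: alg_closed_field) mpoly"
  assumes "\<And>i. n i > 0" and "Gcd (range n) = 1"
    and "minimally_generates n"
    and "pseudo_symmetric (num_semigroup n)"
    and "n 1 < n 2" and "n 2 < n 3" and "n 3 < n 4"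
    and "\<And>i. \<alpha> i > 1" and "0 < \<alpha>21" and "\<alpha>21 < \<alpha> 1 - 1"
    and "n 1 = \<alpha> 2 * \<alpha> 3 * (\<alpha> 4 - 1) + 1"
    and "n 2 = \<alpha>21 * \<alpha> 3 * \<alpha> 4 + (\<alpha> 1 - \<alpha>21 - 1) * (\<alpha> 3 - 1) + \<alpha> 3"
    and "n 3 = \<alpha> 1 * \<alpha> 4 + (\<alpha> 1 - \<alpha>21 - 1) * (\<alpha> 2 - 1) * (\<alpha> 4 - 1) - \<alpha> 4 + 1"
    and "n 4 = \<alpha> 1 * \<alpha> 2 * (\<alpha> 3 - 1) + \<alpha>21 * (\<alpha> 2 - 1) + \<alpha> 2"
    and "\<alpha> 2 > \<alpha>21 + 1" and "\<alpha> 4 = 2"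
    and "k > 0"
    and "k * (\<alpha> 2 + 1) < (k - 1) * \<alpha> 1 + (k + 1) * \<alpha>21 + \<alpha> 3"
    and "\<And>j. 0 < j \<Longrightarrow> j < k \<Longrightarrow>
           \<not> j * (\<alpha> 2 + 1) < (j - 1) * \<alpha> 1 + (j + 1) * \<alpha>21 + \<alpha> 3"
    and "local_degree_ordering R"
    and "f 1 = X 1 ^ \<alpha> 1 - X 3 * X 4 ^ (\<alpha> 4 - 1)"
    and "f 2 = X 2 ^ \<alpha> 2 - X 1 ^ \<alpha>21 * X 4"
    and "f 3 = X 3 ^ \<alpha> 3 - X 1 ^ (\<alpha> 1 - \<alpha>21 - 1) * X 2"
    and "f 4 = X 4 ^ \<alpha> 4 - X 1 * X 2 ^ (\<alpha> 2 - 1) * X 3 ^ (\<alpha> 3 - 1)"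
    and "f 5 = X 1 ^ (\<alpha>21 + 1) * X 3 ^ (\<alpha> 3 - 1) - X 2 * X 4 ^ (\<alpha> 4 - 1)"
    and "f 6 = X 1 ^ (\<alpha> 1 + \<alpha>21) - X 2 ^ \<alpha> 2 * X 3"
    and "\<And>j. 1 \<le> j \<Longrightarrow> j \<le> k \<Longrightarrow>
           f (6 + j) = X 1 ^ ((j - 1) * \<alpha> 1 + (j + 1) * \<alpha>21 + 1) * X 3 ^ (\<alpha> 3 - j)
                       - X 2 ^ (j * \<alpha> 2 + 1)"
  shows "standard_basis R (f ` {1..6 + k}) (toric_ideal n)"
proof -
  note n_pos = assms(1) and gcd = assms(2) and n12 = assms(5) and n23 = assms(6)
    and k_pos = assms(17) and k_less = assms(18) and k_min = assms(19) and R = assms(20)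
    and f = assms(21-26) and f6 = assms(27)
  note n1 = assms(11)[unfolded assms(16)] and n2 = assms(12)[unfolded assms(16)]
    and n3 = assms(13)[unfolded assms(16)] and n4 = assms(14)[unfolded assms(16)]
  define a b c e where abce: "a = \<alpha> 1" "b = \<alpha> 2" "c = \<alpha> 3" "e = \<alpha>21"
  note unfold = abce[symmetric]
  have pos: "e > 0" "e + 1 < a" "e + 1 < b" "c > 1"
    using assms(8)[of 3] assms(9,10,15) by (auto simp: abce)
  have n1': "n 1 = b * c + 1" using n1 by (simp add: unfold)
  have "b > 0" "c > 0" using pos by auto
  note komeda = komeda_relations[OF pos(2) this n1' n2[folded abce] n3[folded abce] n4[folded abce]]
  have rel: "a * n 1 = n 3 + n 4" "b * n 2 = e * n 1 + n 4" "c * n 3 = (a - e - 1) * n 1 + n 2"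
      "2 * n 4 = n 1 + (b - 1) * n 2 + (c - 1) * n 3" "(e + 1) * n 1 + (c - 1) * n 3 = n 2 + n 4"
    by (fact komeda)+
  have rel6: "(a + e) * n 1 = b * n 2 + n 3"
    using rel(1,2) by (simp add: algebra_simps)
  define B where "B j = (j - 1) * a + (j + 1) * e + 1" for j
  have chain: "B j * n 1 + (c - j) * n 3 = (j * b + 1) * n 2" if "1 \<le> j" "j \<le> c" for j
    unfolding B_def using weight_chain[OF rel(1,2,5) that] .

  \<comment> \<open>Degree comparisons and the bound on \<open>k\<close>\<close>
  have deg3: "c < a - e"
  proof -
    \<comment> \<open>At equal weight, heavier variables mean smaller degree: here
      \<open>X 3\<close> outweighs \<open>X 1\<close> and \<open>X 2\<close>. The bound
      \<open>deg6\<close> arises likewise, with \<open>X 1\<close> as the lightest variable.\<close>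
    have "(a - e - 1) * n 1 \<le> (a - e - 1) * n 3" using n12 n23 by simp
    then have "c * n 3 < (a - e - 1) * n 3 + n 3" using rel(3) n23 by linarith
    also have "\<dots> = (a - e) * n 3" using pos by (cases "a - e") auto
    finally show ?thesis by simp
  qed
  have deg6: "b + 1 < a + e"
  proof (rule ccontr)
    assume "\<not> ?thesis"
    then have "(a + e) * n 1 \<le> (b + 1) * n 1" by (intro mult_right_mono) auto
    also have "\<dots> = b * n 1 + n 1" by (rule add_mult_distrib[of b 1, unfolded mult_1])
    also have "b * n 1 \<le> b * n 2" using n12 by simp
    also have "b * n 2 + n 1 < b * n 2 + n 3" using n12 n23 by simp
    finally show False using rel6 by simp
  qed
  have k_le: "k \<le> c"
  proof (rule ccontr)
    assume "\<not> k \<le> c"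
    \<comment> \<open>At \<open>j = c\<close> the inequality that selects \<open>k\<close> reads
      \<open>n 1 + c - 1 < n 2 + c - 1\<close>, so it holds and \<open>k\<close> cannot exceed
      \<open>c\<close>.\<close>
    then have "\<not> c * (b + 1) < (c - 1) * a + (c + 1) * e + c"
      using k_min[of c] pos by (simp add: unfold)
    moreover have "n 2 = (c - 1) * a + (c + 1) * e + 1"
    proof -
      obtain a' c' where "a = e + 1 + a'" "c = Suc c'"
        using pos by (metis gr0_conv_Suc less_imp_add_positive less_trans zero_less_one)
      then show ?thesis using n2 by (simp add: unfold algebra_simps)
    qed
    ultimately show False using n12 n1' by (simp add: algebra_simps)
  qed
  \<comment> \<open>The inequality defining \<open>k\<close> compares the degrees of the two
    monomials of \<open>f (6 + k)\<close>.\<close>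
  have degk: "k * b + 1 < B k + (c - k)"
    using k_less k_le by (simp add: unfold B_def)

  \<comment> \<open>The binomials and their leading monomials\<close>
  let ?M = "\<lambda>p q r s. Poly_Mapping.single (mon p q r s) (1 :: 'k)"
  have f_eqs: "f 1 = ?M a 0 0 0 - ?M 0 0 1 1" "f 2 = ?M 0 b 0 0 - ?M e 0 0 1"
    "f 3 = ?M 0 0 c 0 - ?M (a - e - 1) 1 0 0" "f 4 = ?M 0 0 0 2 - ?M 1 (b - 1) (c - 1) 0"
    "f 5 = ?M (e + 1) 0 (c - 1) 0 - ?M 0 1 0 1" "f 6 = ?M (a + e) 0 0 0 - ?M 0 b 1 0"
    unfolding f assms(16) unfold by (simp_all flip: X_mon)
  have fj_eq: "f (6 + j) = ?M (B j) 0 (c - j) 0 - ?M 0 (j * b + 1) 0 0" if "1 \<le> j" "j \<le> k" for j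
    unfolding f6[OF that] unfold B_def by (simp flip: X_mon)

  have lin: "linear_order R"
    using R by (simp add: local_degree_ordering_def)
  have LM_deg: "LM R (Poly_Mapping.single s 1 - Poly_Mapping.single t (1 :: 'k)) = s"
    "LM R (Poly_Mapping.single t 1 - Poly_Mapping.single s (1 :: 'k)) = s"
    if "total_degree s < total_degree t" for s t
  proof -
    have "s \<noteq> t" "(t, s) \<in> R"
      using that R by (auto simp: local_degree_ordering_def)
    then show "LM R (Poly_Mapping.single s 1 - Poly_Mapping.single t (1 :: 'k)) = s"
      "LM R (Poly_Mapping.single t 1 - Poly_Mapping.single s (1 :: 'k)) = s"
      using LM_binomial[OF lin] by blast+
  qed
  \<comment> \<open>The two degrees differ strictly in each of \<open>f 1\<close> to
    \<open>f 6\<close>, so no tie-breaking rule matters; \<open>\<alpha>21 + 1 < \<alpha> 2\<close>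
    decides \<open>f 2\<close>.\<close>
  have LM_f: "LM R (f 1) = mon 0 0 1 1" "LM R (f 2) = mon e 0 0 1" "LM R (f 3) = mon 0 0 c 0"
    "LM R (f 4) = mon 0 0 0 2" "LM R (f 5) = mon 0 1 0 1" "LM R (f 6) = mon 0 b 1 0"
    unfolding f_eqs using pos deg3 deg6 by (auto intro!: LM_deg simp: total_degree_mon)

  \<comment> \<open>\<open>K < k\<close> can occur when the ordering breaks a tie of total degrees in favour of \<open>X\<^sub>2\<close>.\<close>
  define Q where "Q j \<longleftrightarrow> 1 \<le> j \<and> (mon (B j) 0 (c - j) 0, mon 0 (j * b + 1) 0 0) \<in> R" for j
  define K where "K = (LEAST j. Q j)"
  have "Q k"
    using R degk k_pos by (auto simp: Q_def local_degree_ordering_def total_degree_mon)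
  then have QK: "Q K" and K_le: "K \<le> k"
    unfolding K_def by (auto intro: LeastI Least_le)
  then have K: "1 \<le> K" "K \<le> c"
    using k_le by (auto simp: Q_def)
  have neq: "mon (B j) 0 (c - j) 0 \<noteq> mon 0 (j * b + 1) 0 0" for j
    by (simp add: mon_eq_iff)
  have LM_K: "LM R (f (6 + K)) = mon 0 (K * b + 1) 0 0"
    unfolding fj_eq[OF K(1) K_le] using QK neq[of K]
    by (intro LM_binomial(2)[OF lin]) (auto simp: Q_def)
  have LM_j: "LM R (f (6 + j)) = mon (B j) 0 (c - j) 0" if j: "1 \<le> j" "j < K" for j
  proof -
    have "\<not> Q j" using j(2) unfolding K_def by (rule not_less_Least)
    moreover have "total R" using lin by (simp add: order_on_defs)
    ultimately have "(mon 0 (j * b + 1) 0 0, mon (B j) 0 (c - j) 0) \<in> R"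
      using j(1) neq[of j] by (auto simp: Q_def total_on_def)
    then show ?thesis
      using j K_le neq[of j] by (simp only: fj_eq) (intro LM_binomial(1)[OF lin])
  qed

  \<comment> \<open>Reduced monomials and injectivity of the weight\<close>
  let ?G = "f ` {1..6 + k}"
  have red: "reduced_exponents a b c e K (p, q, r, s)" if "reduced R ?G (mon p q r s)" for p q r s
  proof -
    have D: "p < p' \<or> q < q' \<or> r < r' \<or> s < s'"
      if "1 \<le> i" "i \<le> 6 + k" and LM: "LM R (f i) = mon p' q' r' s'" for i p' q' r' s'
    proof (rule ccontr)
      assume "\<not> ?thesis"
      then have "\<forall>l. \<not> Poly_Mapping.lookup (mon p q r s) l < Poly_Mapping.lookup (mon p' q' r' s') l"
        by (simp only: all_4 lookup_mon) simp
      moreover have "f i \<in> ?G" using that by simp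
      ultimately show False
        using \<open>reduced R ?G (mon p q r s)\<close> LM unfolding reduced_def by metis
    qed
    have "p < B j \<or> r < c - j" if "1 \<le> j" "j < K" for j
      using D[OF _ _ LM_j[OF that]] that K_le by simp
    then have "\<forall>j. 1 \<le> j \<longrightarrow> j < K \<longrightarrow> c - j \<le> r \<longrightarrow> p < B j"
      using leD by blast
    moreover have "r < 1 \<or> s < 1" "p < e \<or> s < 1" "r < c" "s < 2" "q < 1 \<or> s < 1" "q < b \<or> r < 1"
      using D[OF _ _ LM_f(1)] D[OF _ _ LM_f(2)] D[OF _ _ LM_f(3)] D[OF _ _ LM_f(4)]
        D[OF _ _ LM_f(5)] D[OF _ _ LM_f(6)] by simp_all
    moreover have "q < K * b + 1"
      using D[OF _ _ LM_K] K_le by simp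
    ultimately show ?thesis
      unfolding reduced_exponents_def B_def by auto
  qed
  \<comment> \<open>A common divisor of \<open>n 1\<close> and \<open>n 2\<close> divides
    \<open>n 4\<close> by the relation of \<open>f 2\<close>, then \<open>n 3\<close> by that of
    \<open>f 1\<close>, hence the gcd of all generators.\<close>
  have cop: "coprime (n 1) (n 2)"
  proof (rule coprimeI)
    fix d assume d: "d dvd n 1" "d dvd n 2"
    have "d dvd e * n 1 + n 4" using d by (simp flip: rel(2))
    then have d4: "d dvd n 4" using d(1) by (simp add: dvd_add_right_iff)
    have "d dvd n 3 + n 4" using d by (simp flip: rel(1))
    then have "d dvd n 3" using d4 by (simp add: dvd_add_left_iff)
    then have "\<forall>i. d dvd n i" using d d4 by (simp only: all_4)
    then have "d dvd Gcd (range n)" by (auto intro: Gcd_greatest)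
    then show "is_unit d" by (simp add: gcd)
  qed
  have inj: "inj_on (weight n) {m. reduced R ?G m}"
  proof (rule inj_onI)
    fix m m' assume m: "m \<in> {m. reduced R ?G m}" "m' \<in> {m. reduced R ?G m}" "weight n m = weight n m'"
    obtain p q r s p' q' r' s' where mm': "m = mon p q r s" "m' = mon p' q' r' s'"
      by (metis mon_surj)
    have "(p, q, r, s) = (p', q', r', s')"
      using pos m red by (intro inj_onD[OF inj_on_weight_reduced_exponents[OF rel(1,2,5) n1' cop K]])
        (auto simp: mm' weight_mon)
    then show "m = m'" by (simp add: mm')
  qed

  \<comment> \<open>Equal weights within each binomial\<close>
  have binomial: "\<exists>s t. s \<noteq> t \<and> weight n s = weight n t \<and>
      g = Poly_Mapping.single s 1 - Poly_Mapping.single t 1" if g: "g \<in> ?G" for g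
  proof -
    have I: ?thesis if "g = ?M p q r s - ?M p' q' r' s'" "(p, q, r, s) \<noteq> (p', q', r', s')"
        "p * n 1 + q * n 2 + r * n 3 + s * n 4 = p' * n 1 + q' * n 2 + r' * n 3 + s' * n 4"
      for p q r s p' q' r' s'
      by (rule exI[of _ "mon p q r s"], rule exI[of _ "mon p' q' r' s'"])
        (use that in \<open>simp add: mon_eq_iff weight_mon\<close>)
    obtain i where i: "g = f i" "1 \<le> i" "i \<le> 6 + k" using g by auto
    then have "i = 1 \<or> i = 2 \<or> i = 3 \<or> i = 4 \<or> i = 5 \<or> i = 6 \<or> 7 \<le> i"
      by presburger
    then consider "i = 1" | "i = 2" | "i = 3" | "i = 4" | "i = 5" | "i = 6" | "7 \<le> i" by blast
    then show ?thesis
    proof cases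
      case 1 show ?thesis by (rule I[OF i(1)[unfolded 1 f_eqs]]) (use rel pos in simp_all)
    next
      case 2 show ?thesis by (rule I[OF i(1)[unfolded 2 f_eqs]]) (use rel pos in simp_all)
    next
      case 3 show ?thesis by (rule I[OF i(1)[unfolded 3 f_eqs]]) (use rel pos in simp_all)
    next
      case 4 show ?thesis by (rule I[OF i(1)[unfolded 4 f_eqs]]) (use rel pos in simp_all)
    next
      case 5 show ?thesis by (rule I[OF i(1)[unfolded 5 f_eqs]]) (use rel pos in simp_all)
    next
      case 6 show ?thesis by (rule I[OF i(1)[unfolded 6 f_eqs]]) (use rel6 pos in simp_all)
    next
      case 7
      define j where "j = i - 6"
      have j: "i = 6 + j" "1 \<le> j" "j \<le> k" using 7 i by (auto simp: j_def)
      \<comment> \<open>The bound \<open>k \<le> c\<close> brings every such \<open>j\<close> within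
        the range of \<open>weight_chain\<close>.\<close>
      show ?thesis
        by (rule I[OF i(1)[unfolded j(1) fj_eq[OF j(2,3)]]]) (use chain[of j] j k_le in simp_all)
    qed
  qed
  show ?thesis
    by (rule standard_basis_toric_idealI[OF R n_pos _ binomial inj]) auto
qed

end
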